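(* Let $\mathcal{H}$ be a linear $k$-uniform hypergraph with $n$ vertices and $m$ edges, and let $s\ge1$ and $r\ge ks$ be integers. Then $\sqrt{2s^2(Z(\mathcal{H})-km)}\le \mathtt{E}(\mathcal{L}(\mathcal{H}^r_s))\le s(Z(\mathcal{H})-km)$.
   Context: A hypergraph $\mathcal{H}=(V,E)$ is $k$-uniform ($k\ge2$) if every edge has exactly $k$ vertices; it is linear if any two distinct edges share at most one vertex. The degree $d(v)$ is the number of edges containing $v$, and $Z(\mathcal{H})=\sum_{v\in V}d(v)^2$. For integers $s\ge1$, $r\ge ks$, the power hypergraph $\mathcal{H}^r_s$ is the $r$-uniform hypergraph obtained by replacing each vertex $v\in V$ by a set $\varsigma_v$ of $s$ new vertices and adding to each edge $e\in E$ a set $\varsigma_e$ of $r-ks$ new vertices (all these sets pairwise disjoint): its edges are $\varsigma_e\cup\varsigma_{v_1}\cup\cdots\cup\varsigma_{v_k}$ for each $e=\{v_1,\dots,v_k\}\in E$. The line multigraph $\mathcal{L}(\mathcal{G})$ of a hypergraph $\mathcal{G}$ has the edges of $\mathcal{G}$ as vertices, with $|e\cap f|$ edges between distinct $e,f$; its adjacency matrix has entry $|e\cap f|$ for $e\neq f$ and $0$ on the diagonal. $\mathtt{E}(\mathcal{L}(\mathcal{G}))$ is the sum of the absolute values of the eigenvalues of this adjacency matrix. *)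

theory Defs
  imports Complex_Main "Jordan_Normal_Form.Char_Poly"
begin

section \<open>Hypergraphs\<close>

type_synonym 'a hypergraph = "'a set \<times> 'a set set"

abbreviation hverts :: "'a hypergraph \<Rightarrow> 'a set" where
  "hverts \<equiv> fst"

abbreviation hedges :: "'a hypergraph \<Rightarrow> 'a set set" where
  "hedges \<equiv> snd"

definition hypergraph :: "'a hypergraph \<Rightarrow> bool" where
  "hypergraph H \<longleftrightarrow> finite (hverts H) \<and> (\<forall>e\<in>hedges H. e \<subseteq> hverts H)"

definition uniform_hypergraph :: "nat \<Rightarrow> 'a hypergraph \<Rightarrow> bool" where
  "uniform_hypergraph k H \<longleftrightarrow> (\<forall>e\<in>hedges H. card e = k)"

definition linear_hypergraph :: "'a hypergraph \<Rightarrow> bool" where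
  "linear_hypergraph H \<longleftrightarrow> (\<forall>e\<in>hedges H. \<forall>f\<in>hedges H. e \<noteq> f \<longrightarrow> card (e \<inter> f) \<le> 1)"

definition hdegree :: "'a hypergraph \<Rightarrow> 'a \<Rightarrow> nat" where
  "hdegree H v = card {e \<in> hedges H. v \<in> e}"

definition zagreb :: "'a hypergraph \<Rightarrow> nat" where
  "zagreb H = (\<Sum>v\<in>hverts H. (hdegree H v)\<^sup>2)"


section \<open>Power hypergraphs\<close>

datatype 'a pvertex = Vertex_Copy 'a nat | Edge_Extra "'a set" nat

definition vertex_copies :: "nat \<Rightarrow> 'a \<Rightarrow> 'a pvertex set" where
  "vertex_copies s v = Vertex_Copy v ` {..<s}"

definition edge_extras :: "nat \<Rightarrow> 'a set \<Rightarrow> 'a pvertex set" where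
  "edge_extras t e = Edge_Extra e ` {..<t}"

text \<open>The first argument is the uniformity \<open>k\<close> of the underlying hypergraph; the truncated
  subtraction is meant for \<open>k * s \<le> r\<close>.\<close>

definition power_hypergraph :: "nat \<Rightarrow> nat \<Rightarrow> nat \<Rightarrow> 'a hypergraph \<Rightarrow> 'a pvertex hypergraph" where
  "power_hypergraph k r s H =
     ((\<Union>v\<in>hverts H. vertex_copies s v) \<union> (\<Union>e\<in>hedges H. edge_extras (r - k * s) e),
      (\<lambda>e. edge_extras (r - k * s) e \<union> (\<Union>v\<in>e. vertex_copies s v)) ` hedges H)"

lemma hypergraph_power:
  assumes "hypergraph H"
  shows "hypergraph (power_hypergraph k r s H)"
proof -
  have "hedges H \<subseteq> Pow (hverts H)" and "finite (hverts H)"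
    using assms by (auto simp: hypergraph_def)
  then have "finite (hedges H)"
    by (meson finite_Pow_iff finite_subset)
  then show ?thesis
    using assms
    by (fastforce simp: hypergraph_def power_hypergraph_def vertex_copies_def edge_extras_def)
qed

lemma uniform_power:
  assumes "hypergraph H" and "uniform_hypergraph k H" and "k * s \<le> r"
  shows "uniform_hypergraph r (power_hypergraph k r s H)"
proof -
  have "card (edge_extras (r - k * s) e \<union> (\<Union>v\<in>e. vertex_copies s v)) = r"
    if e: "e \<in> hedges H" for e
  proof -
    have fin: "finite e" and k: "card e = k"
      using assms e by (auto simp: hypergraph_def uniform_hypergraph_def intro: finite_subset)
    have "card (\<Union>v\<in>e. vertex_copies s v) = (\<Sum>v\<in>e. card (vertex_copies s v))"
      by (rule card_UN_disjoint) (use fin in \<open>auto simp: vertex_copies_def\<close>)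
    also have "\<dots> = k * s"
      by (simp add: vertex_copies_def card_image inj_on_def k)
    finally have 1: "card (\<Union>v\<in>e. vertex_copies s v) = k * s" .
    have 2: "card (edge_extras (r - k * s) e) = r - k * s"
      by (simp add: edge_extras_def card_image inj_on_def)
    show ?thesis
      by (subst card_Un_disjoint)
        (use fin 1 2 assms(3) in \<open>auto simp: vertex_copies_def edge_extras_def\<close>)
  qed
  then show ?thesis
    by (auto simp: uniform_hypergraph_def power_hypergraph_def)
qed


section \<open>Multigraphs and their energy\<close>

text \<open>A loopless multigraph is a vertex set with a function counting the edges between two
  vertices.\<close>

type_synonym 'b multigraph = "'b set \<times> ('b \<Rightarrow> 'b \<Rightarrow> nat)"

definition line_multigraph :: "'a hypergraph \<Rightarrow> 'a set multigraph" where
  "line_multigraph G = (hedges G, \<lambda>e f. if e = f then 0 else card (e \<inter> f))"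

definition adjacency_matrix :: "'b multigraph \<Rightarrow> 'b list \<Rightarrow> complex mat" where
  "adjacency_matrix M vs =
     mat (length vs) (length vs) (\<lambda>(i, j). of_nat (snd M (vs ! i) (vs ! j)))"

text \<open>Eigenvalues are counted with their algebraic multiplicity.\<close>

definition matrix_energy :: "complex mat \<Rightarrow> real" where
  "matrix_energy A = (\<Sum>x | eigenvalue A x. real (order x (char_poly A)) * cmod x)"

text \<open>The vertices have to be enumerated to obtain a matrix; by \<open>energy_eq\<close> below the choice
  of enumeration is immaterial.\<close>

definition energy :: "'b multigraph \<Rightarrow> real" where
  "energy M = matrix_energy (adjacency_matrix M (SOME vs. distinct vs \<and> set vs = fst M))"

lemma matrix_energy_adjacency_matrix_cong:
  assumes xs: "distinct xs" and ys: "distinct ys" and eq: "set xs = set ys"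
  shows "matrix_energy (adjacency_matrix M xs) = matrix_energy (adjacency_matrix M ys)"
proof -
  define n where "n = length xs"
  have n': "length ys = n"
    using assms by (metis distinct_card n_def)
  have "\<forall>i<n. \<exists>j<n. ys ! j = xs ! i"
    using eq n' n_def by (metis in_set_conv_nth)
  then obtain p where p: "\<And>i. i < n \<Longrightarrow> p i < n" "\<And>i. i < n \<Longrightarrow> ys ! p i = xs ! i"
    by metis
  have "\<forall>i<n. \<exists>j<n. xs ! j = ys ! i"
    using eq n' n_def by (metis in_set_conv_nth)
  then obtain q where q: "\<And>i. i < n \<Longrightarrow> q i < n" "\<And>i. i < n \<Longrightarrow> xs ! q i = ys ! i"
    by metis
  have pe: "xs ! i = ys ! l \<longleftrightarrow> l = p i" if "i < n" "l < n" for i l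
    using that p ys n' by (metis nth_eq_iff_index_eq)
  have qe: "xs ! l = ys ! i \<longleftrightarrow> l = q i" if "i < n" "l < n" for i l
    using that q xs n_def by (metis nth_eq_iff_index_eq)
  have xe: "xs ! i = xs ! j \<longleftrightarrow> i = j" if "i < n" "j < n" for i j
    using that xs n_def by (metis nth_eq_iff_index_eq)
  have ye: "ys ! i = ys ! j \<longleftrightarrow> i = j" if "i < n" "j < n" for i j
    using that ys n' by (metis nth_eq_iff_index_eq)
  define A where "A = adjacency_matrix M xs"
  define B where "B = adjacency_matrix M ys"
  define P :: "complex mat" where "P = mat n n (\<lambda>(i, j). if xs ! i = ys ! j then 1 else 0)"
  define Q :: "complex mat" where "Q = mat n n (\<lambda>(i, j). if xs ! j = ys ! i then 1 else 0)"
  have carr: "A \<in> carrier_mat n n" "B \<in> carrier_mat n n" "P \<in> carrier_mat n n" "Q \<in> carrier_mat n n"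
    by (auto simp: A_def B_def P_def Q_def adjacency_matrix_def n_def n')
  have PQ: "P * Q = 1\<^sub>m n"
  proof (rule eq_matI)
    fix i j assume "i < dim_row (1\<^sub>m n :: complex mat)" "j < dim_col (1\<^sub>m n :: complex mat)"
    then have ij: "i < n" "j < n" by auto
    have "(P * Q) $$ (i, j) =
        (\<Sum>l\<in>{0..<n}. (if xs ! i = ys ! l then 1 else 0) * (if xs ! j = ys ! l then 1 else 0))"
      using ij by (simp add: P_def Q_def scalar_prod_def)
    also have "\<dots> = (\<Sum>l\<in>{0..<n}. if l = p i then (if xs ! j = ys ! l then 1 else 0) else 0)"
      by (rule sum.cong) (use ij pe in auto)
    also have "\<dots> = (1\<^sub>m n) $$ (i, j)"
      using ij p xe by auto
    finally show "(P * Q) $$ (i, j) = (1\<^sub>m n) $$ (i, j)" .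
  qed (use carr in auto)
  have QP: "Q * P = 1\<^sub>m n"
  proof (rule eq_matI)
    fix i j assume "i < dim_row (1\<^sub>m n :: complex mat)" "j < dim_col (1\<^sub>m n :: complex mat)"
    then have ij: "i < n" "j < n" by auto
    have "(Q * P) $$ (i, j) =
        (\<Sum>l\<in>{0..<n}. (if xs ! l = ys ! i then 1 else 0) * (if xs ! l = ys ! j then 1 else 0))"
      using ij by (simp add: P_def Q_def scalar_prod_def)
    also have "\<dots> = (\<Sum>l\<in>{0..<n}. if l = q i then (if xs ! l = ys ! j then 1 else 0) else 0)"
      by (rule sum.cong) (use ij qe in auto)
    also have "\<dots> = (1\<^sub>m n) $$ (i, j)"
      using ij q ye by auto
    finally show "(Q * P) $$ (i, j) = (1\<^sub>m n) $$ (i, j)" .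
  qed (use carr in auto)
  have "A * P = P * B"
  proof (rule eq_matI)
    fix i j assume "i < dim_row (P * B)" "j < dim_col (P * B)"
    then have ij: "i < n" "j < n" using carr by auto
    have "(A * P) $$ (i, j) =
        (\<Sum>l\<in>{0..<n}. of_nat (snd M (xs ! i) (xs ! l)) * (if xs ! l = ys ! j then 1 else 0))"
      using ij by (simp add: A_def P_def adjacency_matrix_def scalar_prod_def n_def n')
    also have "\<dots> = (\<Sum>l\<in>{0..<n}. if l = q j then of_nat (snd M (xs ! i) (xs ! l)) else 0)"
      by (rule sum.cong) (use ij qe in auto)
    also have "\<dots> = of_nat (snd M (xs ! i) (ys ! j))"
      using ij q by auto
    also have "\<dots> = (\<Sum>l\<in>{0..<n}. if l = p i then of_nat (snd M (ys ! l) (ys ! j)) else 0)"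
      using ij p by auto
    also have "\<dots> =
        (\<Sum>l\<in>{0..<n}. (if xs ! i = ys ! l then 1 else 0) * of_nat (snd M (ys ! l) (ys ! j)))"
      by (rule sum.cong) (use ij pe in auto)
    also have "\<dots> = (P * B) $$ (i, j)"
      using ij by (simp add: B_def P_def adjacency_matrix_def scalar_prod_def n')
    finally show "(A * P) $$ (i, j) = (P * B) $$ (i, j)" .
  qed (use carr in auto)
  then have "P * B * Q = A * P * Q" by simp
  also have "\<dots> = A * (P * Q)" using carr by (rule_tac assoc_mult_mat) auto
  also have "\<dots> = A" using carr PQ by simp
  finally have "similar_mat A B"
    unfolding similar_mat_def using similar_mat_witI[OF PQ QP _ carr] by metis
  then have "char_poly A = char_poly B"
    by (rule char_poly_similar)
  then show ?thesis
    using eigenvalue_root_char_poly[OF carr(1)] eigenvalue_root_char_poly[OF carr(2)]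
    by (simp add: matrix_energy_def A_def[symmetric] B_def[symmetric])
qed

lemma energy_eq:
  assumes "distinct vs" and "set vs = fst M"
  shows "energy M = matrix_energy (adjacency_matrix M vs)"
proof -
  let ?vs = "SOME vs. distinct vs \<and> set vs = fst M"
  have "distinct ?vs \<and> set ?vs = fst M"
    by (rule someI[of _ vs]) (use assms in simp)
  then show ?thesis
    unfolding energy_def using assms by (intro matrix_energy_adjacency_matrix_cong) auto
qed

end

theory Submission
  imports Defs "Jordan_Normal_Form.Schur_Decomposition"
begin

text \<open>Write \<open>A\<close> for the adjacency matrix and triangularise it as \<open>B = U\<^sup>* A U\<close> with \<open>U\<close> unitary, so
  that the diagonal of \<open>B\<close> lists the eigenvalues \<open>x\<^sub>i\<close>. Expanding \<open>x\<^sub>i = u\<^sub>i\<^sup>* A u\<^sub>i\<close>, using AM-GM on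
  products of entries of \<open>U\<close> and the unit length of its rows gives \<open>\<Sum>\<bar>x\<^sub>i\<bar> \<le> \<Sum>\<bar>a\<^sub>j\<^sub>k\<bar>\<close>. As the trace
  vanishes, each \<open>\<bar>x\<^sub>i\<bar>\<close> is at most half of \<open>\<Sum>\<bar>x\<^sub>j\<bar>\<close>, hence \<open>2 \<bar>tr A\<^sup>2\<bar> \<le> (\<Sum>\<bar>x\<^sub>i\<bar>)\<^sup>2\<close>. By linearity
  the entries of \<open>A\<close> are \<open>0\<close> or \<open>s\<close>, and double counting incident pairs of edges shows that
  \<open>Z(H) - k m\<close> of them are nonzero.\<close>

section \<open>Unitary triangularisation\<close>

lemma mat_adjoint_carrier [simp]:
  "A \<in> carrier_mat n m \<Longrightarrow> mat_adjoint A \<in> carrier_mat m n"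
  by (auto simp: mat_adjoint_def mat_of_rows_def)

lemma mat_adjoint_dim [simp]:
  "dim_row (mat_adjoint A) = dim_col A" "dim_col (mat_adjoint A) = dim_row A"
  by (auto simp: mat_adjoint_def mat_of_rows_def)

lemma index_mat_adjoint:
  assumes "A \<in> carrier_mat n m" "i < m" "j < n"
  shows "mat_adjoint A $$ (i, j) = conjugate (A $$ (j, i))"
  using assms by (auto simp: mat_adjoint_def mat_of_rows_def)

lemma mat_adjoint_mult:
  fixes A B :: "complex mat"
  assumes A: "A \<in> carrier_mat n m" and B: "B \<in> carrier_mat m l"
  shows "mat_adjoint (A * B) = mat_adjoint B * mat_adjoint A"
proof (rule eq_matI)
  fix i j
  assume "i < dim_row (mat_adjoint B * mat_adjoint A)" "j < dim_col (mat_adjoint B * mat_adjoint A)"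
  then have ij: "i < l" "j < n"
    using mat_adjoint_carrier[OF A] mat_adjoint_carrier[OF B] by auto
  have "mat_adjoint (A * B) $$ (i, j) = conjugate ((A * B) $$ (j, i))"
    using A B ij by (intro index_mat_adjoint) auto
  also have "\<dots> = (\<Sum>k\<in>{0..<m}. conjugate (B $$ (k, i)) * conjugate (A $$ (j, k)))"
    using A B ij by (simp add: scalar_prod_def mult.commute)
  also have "\<dots> = (\<Sum>k\<in>{0..<m}. mat_adjoint B $$ (i, k) * mat_adjoint A $$ (k, j))"
    by (rule sum.cong) (use A B ij in \<open>auto simp: index_mat_adjoint\<close>)
  also have "\<dots> = (mat_adjoint B * mat_adjoint A) $$ (i, j)"
    using A B ij by (simp add: scalar_prod_def)
  finally show "mat_adjoint (A * B) $$ (i, j) = (mat_adjoint B * mat_adjoint A) $$ (i, j)" .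
qed (use mat_adjoint_carrier[OF A] mat_adjoint_carrier[OF B] A B in
      \<open>auto simp: mat_adjoint_def mat_of_rows_def\<close>)

text \<open>Needed in the Schur induction: the unitary factor of the smaller block is padded by a
  leading 1, and its inverse must still be the adjoint after padding.\<close>

lemma mat_adjoint_one_block:
  fixes P :: "complex mat"
  assumes P: "P \<in> carrier_mat n n"
  shows "mat_adjoint (four_block_mat (1\<^sub>m 1) (0\<^sub>m 1 n) (0\<^sub>m n 1) P)
    = four_block_mat (1\<^sub>m 1) (0\<^sub>m 1 n) (0\<^sub>m n 1) (mat_adjoint P)"
    (is "mat_adjoint ?L = ?R")
proof (rule eq_matI)
  have L: "?L \<in> carrier_mat (1 + n) (1 + n)"
    using P by (intro four_block_carrier_mat) auto
  have P': "mat_adjoint P \<in> carrier_mat n n"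
    using P by simp
  have R: "?R \<in> carrier_mat (1 + n) (1 + n)"
    using P' by (intro four_block_carrier_mat) auto
  show "dim_row (mat_adjoint ?L) = dim_row ?R" "dim_col (mat_adjoint ?L) = dim_col ?R"
    using mat_adjoint_carrier[OF L] R by auto
  fix i j
  assume "i < dim_row ?R" "j < dim_col ?R"
  then have ij: "i < 1 + n" "j < 1 + n"
    using R by auto
  have "mat_adjoint ?L $$ (i, j) = conjugate (?L $$ (j, i))"
    using index_mat_adjoint[OF L] ij by simp
  also have "\<dots> = ?R $$ (i, j)"
    using P P' ij by (auto simp: index_mat_adjoint)
  finally show "mat_adjoint ?L $$ (i, j) = ?R $$ (i, j)" .
qed

text \<open>Complete \<open>v\<close> to a basis, apply Gram-Schmidt, which keeps the first vector,
  and normalise. The head clause is what puts an eigenvector into the first column of a unitary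
  matrix.\<close>

lemma orthonormal_completion:
  fixes v :: "complex vec"
  assumes v: "v \<in> carrier_vec n" and v0: "v \<noteq> 0\<^sub>v n"
  obtains us c where "set us \<subseteq> carrier_vec n" "corthogonal us" "length us = n"
    "\<And>u. u \<in> set us \<Longrightarrow> u \<bullet>c u = 1" "hd us = c \<cdot>\<^sub>v v" "c \<noteq> 0"
proof -
  interpret cof_vec_space n "TYPE(complex)" .
  note bc = basis_completion[OF v v0]
  define ws where "ws = gram_schmidt n (basis_completion v)"
  have n: "n \<noteq> 0"
    using v v0 by (metis carrier_vecD eq_vecI index_zero_vec(2) not_less_zero)
  from gram_schmidt_result[OF bc(2) bc(4) bc(5) refl] bc(6)
  have ws: "set ws \<subseteq> carrier_vec n" "corthogonal ws" "length ws = n"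
    by (auto simp: ws_def)
  obtain vs where "basis_completion v = v # vs"
    using bc(6,7) n by (cases "basis_completion v") auto
  then have hd_ws: "hd ws = v"
    using v by (simp add: ws_def)
  \<comment> \<open>The reciprocal of the norm of \<open>w\<close>; the real part is taken so that
    the real square root applies.\<close>
  define c :: "complex vec \<Rightarrow> complex" where "c w = inverse (of_real (sqrt (Re (w \<bullet>c w))))" for w
  define us where "us = map (\<lambda>w. c w \<cdot>\<^sub>v w) ws"
  \<comment> \<open>Nonnegativity in the order on complex numbers forces
    \<open>w \<bullet>c w\<close> to be real, and \<open>corthogonal\<close> excludes the value
    0.\<close>
  have pos: "Re (w \<bullet>c w) > 0 \<and> w \<bullet>c w = of_real (Re (w \<bullet>c w))" if w: "w \<in> set ws" for w
  proof -
    obtain i where i: "i < length ws" "w = ws ! i"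
      using w by (metis in_set_conv_nth)
    have "w \<bullet>c w \<noteq> 0"
      using corthogonalD[OF ws(2) i(1) i(1)] i by simp
    moreover have "w \<bullet>c w \<ge> 0"
      by (rule conjugate_square_ge_0_vec)
    ultimately show ?thesis
      by (auto simp: less_eq_complex_def complex_eq_iff)
  qed
  have c0: "c w \<noteq> 0" if "w \<in> set ws" for w
    using pos[OF that] by (simp add: c_def)
  have scale: "(a \<cdot>\<^sub>v x) \<bullet>c (b \<cdot>\<^sub>v y) = a * conjugate b * (x \<bullet>c y)"
    if "x \<in> carrier_vec n" "y \<in> carrier_vec n" for a b :: complex and x y
    using that by (simp add: conjugate_smult_vec)
  show ?thesis
  proof
    show "set us \<subseteq> carrier_vec n" "length us = n"
      using ws by (auto simp: us_def)
    show "corthogonal us"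
    proof (rule corthogonalI)
      fix i j assume "i < length us" "j < length us"
      then have ij: "i < length ws" "j < length ws" by (auto simp: us_def)
      then have "ws ! i \<in> carrier_vec n" "ws ! j \<in> carrier_vec n"
        using ws(1) by auto
      then have "us ! i \<bullet>c us ! j = c (ws ! i) * conjugate (c (ws ! j)) * (ws ! i \<bullet>c ws ! j)"
        using ij unfolding us_def by (simp only: nth_map scale)
      then show "(us ! i \<bullet>c us ! j = 0) = (i \<noteq> j)"
        using c0 ij corthogonalD[OF ws(2) ij] by simp
    qed
    show "u \<bullet>c u = 1" if u: "u \<in> set us" for u
    proof -
      obtain w where w: "w \<in> set ws" "u = c w \<cdot>\<^sub>v w"
        using u by (auto simp: us_def)
      define x where "x = Re (w \<bullet>c w)"
      have x: "x > 0" "w \<bullet>c w = of_real x"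
        using pos[OF w(1)] by (auto simp: x_def)
      have "u \<bullet>c u = c w * conjugate (c w) * (w \<bullet>c w)"
        unfolding w(2) using w(1) ws(1) by (intro scale) auto
      also have "\<dots> = inverse (of_real (sqrt x)) * inverse (of_real (sqrt x)) * of_real x"
        using x by (simp add: c_def)
      also have "\<dots> = of_real (inverse (sqrt x) * inverse (sqrt x) * x)"
        by simp
      also have "inverse (sqrt x) * inverse (sqrt x) * x = 1"
        using x(1) by (simp add: field_simps)
      finally show ?thesis by simp
    qed
    have "ws \<noteq> []"
      using ws(3) n by auto
    then show "hd us = c v \<cdot>\<^sub>v v" "c v \<noteq> 0"
      using hd_ws c0[of v] by (auto simp: us_def hd_map dest: hd_in_set)
  qed
qed

text \<open>The similarity matrices of the library's Schur decomposition are products of non-normalised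
  orthogonal ones and hence not unitary, so the induction is redone with orthonormal columns.\<close>

lemma unitary_schur_decomposition:
  fixes A :: "complex mat"
  assumes "A \<in> carrier_mat n n" and "char_poly A = (\<Prod>e\<leftarrow>es. [:- e, 1:])"
  obtains B U where "similar_mat_wit A B U (mat_adjoint U)" "upper_triangular B" "diag_mat B = es"
proof -
  have "\<exists>B U. similar_mat_wit A B U (mat_adjoint U) \<and> upper_triangular B \<and> diag_mat B = es"
    using assms
  proof (induction es arbitrary: n A)
    case Nil
    \<comment> \<open>The degree of the characteristic polynomial is the dimension, and the empty
      product has degree 0.\<close>
    then have "n = 0"
      using degree_monic_char_poly[of A n] by simp
    moreover from this have "mat_adjoint (1\<^sub>m n) = (1\<^sub>m n :: complex mat)"
      by (intro eq_matI) (auto simp: mat_adjoint_def mat_of_rows_def)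
    ultimately show ?case
      using Nil similar_mat_wit_refl[OF Nil(1)]
      by (intro exI[of _ A] exI[of _ "1\<^sub>m n"]) (auto simp: diag_mat_def)
  next
    case (Cons e es)
    note A = Cons.prems(1)
    have cp: "char_poly A = [:- e, 1:] * (\<Prod>e\<leftarrow>es. [:- e, 1:])"
      using Cons.prems(2) by simp
    have ev: "eigenvalue A e"
      unfolding eigenvalue_root_char_poly[OF A] cp by simp
    then obtain v where v: "v \<in> carrier_vec n" "v \<noteq> 0\<^sub>v n" "A *\<^sub>v v = e \<cdot>\<^sub>v v"
      using A by (auto simp: eigenvalue_def eigenvector_def)
    have "n \<noteq> 0"
      using v by (metis carrier_vecD eq_vecI index_zero_vec(2) not_less_zero)
    then obtain n1 where n: "n = 1 + n1"
      by (metis Suc_eq_plus1_left not0_implies_Suc)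
    obtain us c where us: "set us \<subseteq> carrier_vec n" "corthogonal us" "length us = n"
      "\<And>u. u \<in> set us \<Longrightarrow> u \<bullet>c u = 1" "hd us = c \<cdot>\<^sub>v v" "c \<noteq> 0"
      using orthonormal_completion[OF v(1,2)] by metis
    define W where "W = mat_of_cols n us"
    define W' where "W' = mat_adjoint W"
    define A' where "A' = W' * A * W"
    have W: "W \<in> carrier_mat n n" using us by (auto simp: W_def)
    have W': "W' \<in> carrier_mat n n" using W by (simp add: W'_def)
    have "cols W = us" using us by (simp add: W_def)
    \<comment> \<open>\<open>vec_inv\<close> divides the conjugate by the squared norm, which is 1
      here. Hence \<open>corthogonal_inv W\<close> is the plain adjoint; this is where normalisation
      pays off.\<close>
    moreover have "map vec_inv us = map conjugate us"
      using us(4) by (auto simp: vec_inv_def)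
    ultimately have W'_inv: "corthogonal_inv W = W'"
      by (simp only: W'_def corthogonal_inv_def mat_adjoint_def)
    have W'W: "W' * W = 1\<^sub>m n"
      using corthogonal_inv_result[OF orthogonal_mat_of_cols[OF us(1-3)]] W W' W'_inv
      by (simp add: W_def[symmetric] inverts_mat_def)
    have WW': "W * W' = 1\<^sub>m n"
      using mat_mult_left_right_inverse[OF W' W W'W] .
    have A': "A' \<in> carrier_mat n n" using A W W' by (simp add: A'_def)
    have sim: "similar_mat_wit A A' W W'"
      by (rule similar_mat_wit_sym, rule similar_mat_witI[of _ _ n])
        (use A W W' A' W'W WW' in \<open>auto simp: A'_def\<close>)
    have "c \<cdot>\<^sub>v v \<noteq> 0\<^sub>v n"
    proof
      assume *: "c \<cdot>\<^sub>v v = 0\<^sub>v n"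
      have "v = inverse c \<cdot>\<^sub>v (c \<cdot>\<^sub>v v)"
        using us(6) by (simp add: smult_smult_assoc)
      also have "\<dots> = 0\<^sub>v n"
        unfolding * by auto
      finally show False using v(2) by simp
    qed
    moreover have "A *\<^sub>v (c \<cdot>\<^sub>v v) = e \<cdot>\<^sub>v (c \<cdot>\<^sub>v v)"
      using A v by (simp add: mult_mat_vec smult_smult_assoc mult.commute)
    \<comment> \<open>The first column of \<open>W\<close> is an eigenvector for \<open>e\<close>,
      so in the new basis the first column of the matrix is \<open>e\<close> times the first unit
      vector.\<close>
    ultimately have col0: "col A' 0 = vec n (\<lambda>i. if i = 0 then e else 0)"
      using corthogonal_col_ev_0[OF A _ _ _ \<open>n \<noteq> 0\<close> us(5,1-3)] v(1)
      by (simp add: A'_def W'_inv W_def[symmetric])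
    have col0': "A' $$ (i, 0) = (if i = 0 then e else 0)" if "i < n" for i
      using arg_cong[OF col0, of "\<lambda>x. x $ i"] that A' by simp
    obtain A1 A2 A0 A3 where split: "split_block A' 1 1 = (A1, A2, A0, A3)"
      by (cases "split_block A' 1 1") auto
    from split_block[OF split, of n1 n1] A' n
    have blk: "A1 \<in> carrier_mat 1 1" "A2 \<in> carrier_mat 1 n1" "A0 \<in> carrier_mat n1 1"
      "A3 \<in> carrier_mat n1 n1" "A' = four_block_mat A1 A2 A0 A3"
      by auto
    have A1: "A1 = mat 1 1 (\<lambda>_. e)"
      using split col0' A' n by (auto simp: split_block_def Let_def)
    have A0: "A0 = 0\<^sub>m n1 1"
      using split col0' A' n by (auto simp: split_block_def Let_def)
    \<comment> \<open>The lower left block vanishes, so the characteristic polynomial factors.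
      Cancelling the factor of \<open>e\<close> leaves \<open>A3\<close> with the eigenvalues
      \<open>es\<close>, as the induction hypothesis demands.\<close>
    have "char_poly A' = char_poly A1 * char_poly A3"
      unfolding blk(5) A0 by (rule char_poly_four_block_zeros_col[OF blk(1,2,4)])
    moreover have "char_poly A1 = [:- e, 1:]"
      by (simp add: A1 char_poly_defs det_def sign_def)
    moreover have "char_poly A' = char_poly A"
      using sim char_poly_similar by (metis similar_mat_def)
    ultimately have "char_poly A3 = (\<Prod>e\<leftarrow>es. [:- e, 1:])"
      using cp by (metis mult_cancel_left pCons_eq_0_iff zero_neq_one)
    then obtain B P where IH: "similar_mat_wit A3 B P (mat_adjoint P)" "upper_triangular B"
      "diag_mat B = es"
      using Cons.IH[OF blk(4)] by blast
    note IHD = similar_mat_witD2[OF blk(4) IH(1)]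
    define P1 where "P1 = four_block_mat (1\<^sub>m 1) (0\<^sub>m 1 n1) (0\<^sub>m n1 1) P"
    define Q1 where "Q1 = four_block_mat (1\<^sub>m 1) (0\<^sub>m 1 n1) (0\<^sub>m n1 1) (mat_adjoint P)"
    \<comment> \<open>Conjugation by the padded unitary keeps the first column and turns the blocks
      \<open>A2\<close> and \<open>A3\<close> into \<open>A2 * P\<close> and
      \<open>B\<close>.\<close>
    define C where "C = four_block_mat A1 (A2 * P) A0 B"
    have P1: "P1 \<in> carrier_mat n n"
      using IHD n unfolding P1_def by (auto intro: four_block_carrier_mat)
    have A0_eq: "A0 = P * A0 * 1\<^sub>m 1"
      using IHD by (simp add: A0)
    have A2_eq: "A2 = 1\<^sub>m 1 * (A2 * P) * mat_adjoint P"
      using IHD(1,6,7) blk(2) by (simp add: assoc_mult_mat[OF blk(2) IHD(6,7)])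
    have "similar_mat_wit A' C P1 Q1"
      unfolding blk(5) C_def P1_def Q1_def
      by (rule similar_mat_wit_four_block[OF similar_mat_wit_refl[OF blk(1)] IH(1) A2_eq A0_eq
            blk(1,4,3)])
        (use IHD(6) blk(2) in simp)
    from similar_mat_wit_trans[OF sim this]
    have "similar_mat_wit A C (W * P1) (Q1 * W')" .
    \<comment> \<open>The adjoint reverses products, so the composed similarity again has its
      adjoint as inverse.\<close>
    moreover have "mat_adjoint (W * P1) = Q1 * W'"
      using mat_adjoint_mult[OF W P1] mat_adjoint_one_block[OF IHD(6)]
      by (simp only: P1_def Q1_def W'_def)
    moreover have "upper_triangular C"
      unfolding C_def A0
      by (intro upper_triangular_four_block[OF _ _ _ IH(2)]) (use IHD in \<open>auto simp: A1\<close>)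
    moreover have "diag_mat C = e # es"
      using diag_four_block_mat[OF blk(1) IHD(5)] IH(3) by (simp add: C_def A1 diag_mat_def)
    ultimately show ?case
      by (intro exI[of _ C] exI[of _ "W * P1"]) simp
  qed
  then show ?thesis using that by blast
qed


section \<open>Eigenvalue sums\<close>

lemma sum_count_list_times:
  fixes f :: "'a \<Rightarrow> real"
  assumes "finite S" "set xs \<subseteq> S"
  shows "(\<Sum>x\<in>S. real (count_list xs x) * f x) = (\<Sum>x\<leftarrow>xs. f x)"
  using assms(2)
proof (induction xs)
  case (Cons a xs)
  have "(\<Sum>x\<in>S. real (count_list (a # xs) x) * f x)
      = (\<Sum>x\<in>S. real (count_list xs x) * f x + (if a = x then f x else 0))"
    by (rule sum.cong) (auto simp: algebra_simps)
  also have "\<dots> = (\<Sum>x\<leftarrow>a # xs. f x)"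
    using Cons assms(1) by (simp add: sum.distrib)
  finally show ?case .
qed simp

lemma order_prod_linear:
  fixes es :: "'a::field list"
  shows "Polynomial.order x (\<Prod>e\<leftarrow>es. [:- e, 1:]) = count_list es x"
proof (induction es)
  case (Cons e es)
  have "(\<Prod>e\<leftarrow>es. [:- e, 1:]) \<noteq> 0"
    by (auto simp: prod_list_zero_iff)
  then have "Polynomial.order x (\<Prod>e\<leftarrow>e # es. [:- e, 1:])
      = Polynomial.order x [:- e, 1:] + Polynomial.order x (\<Prod>e\<leftarrow>es. [:- e, 1:])"
    by (simp add: order_mult del: mult_pCons_left)
  then show ?case
    using Cons by (simp add: order_linear')
qed simp

text \<open>The order of a root is the number of its occurrences in \<open>es\<close>, so the sum
  weighted by multiplicity becomes a plain sum over the list.\<close>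

lemma matrix_energy_eq_sum_list:
  assumes A: "A \<in> carrier_mat n n" and cp: "char_poly A = (\<Prod>e\<leftarrow>es. [:- e, 1:])"
  shows "matrix_energy A = (\<Sum>e\<leftarrow>es. cmod e)"
proof -
  have "{x. eigenvalue A x} = set es"
    by (auto simp: eigenvalue_root_char_poly[OF A] cp poly_prod_list prod_list_zero_iff)
  then show ?thesis
    by (simp add: matrix_energy_def cp order_prod_linear sum_count_list_times)
qed

section \<open>Traces under similarity and for triangular matrices\<close>

lemma sum_diag_mult_commute:
  fixes P Q :: "'a::comm_semiring_0 mat"
  assumes "P \<in> carrier_mat n m" "Q \<in> carrier_mat m n"
  shows "(\<Sum>i<n. (P * Q) $$ (i, i)) = (\<Sum>j<m. (Q * P) $$ (j, j))"
proof -
  have "(\<Sum>i<n. (P * Q) $$ (i, i)) = (\<Sum>i<n. \<Sum>j<m. P $$ (i, j) * Q $$ (j, i))"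
    using assms by (intro sum.cong) (auto simp: scalar_prod_def atLeast0LessThan)
  also have "\<dots> = (\<Sum>j<m. \<Sum>i<n. Q $$ (j, i) * P $$ (i, j))"
    by (subst sum.swap) (simp add: mult.commute)
  also have "\<dots> = (\<Sum>j<m. (Q * P) $$ (j, j))"
    using assms by (intro sum.cong) (auto simp: scalar_prod_def atLeast0LessThan)
  finally show ?thesis .
qed

text \<open>Cyclicity of the trace moves \<open>Q\<close> in front of \<open>P\<close>, where the
  two cancel.\<close>

lemma sum_diag_similar:
  fixes A :: "'a::comm_ring_1 mat"
  assumes A: "A \<in> carrier_mat n n" and sim: "similar_mat_wit A B P Q"
  shows "(\<Sum>i<n. A $$ (i, i)) = (\<Sum>i<n. B $$ (i, i))"
proof -
  note D = similar_mat_witD2[OF A sim]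
  have "(\<Sum>i<n. A $$ (i, i)) = (\<Sum>i<n. (Q * (P * B)) $$ (i, i))"
    unfolding D(3) using D by (intro sum_diag_mult_commute) auto
  also have "Q * (P * B) = Q * P * B"
    using D by (intro assoc_mult_mat[symmetric]) auto
  also have "\<dots> = B"
    using D by simp
  finally show ?thesis .
qed

lemma diag_square_upper_triangular:
  fixes B :: "'a::comm_ring_1 mat"
  assumes B: "B \<in> carrier_mat n n" "upper_triangular B" and i: "i < n"
  shows "(B * B) $$ (i, i) = (B $$ (i, i))\<^sup>2"
proof -
  have "(B * B) $$ (i, i) = (\<Sum>k<n. B $$ (i, k) * B $$ (k, i))"
    using B i by (auto simp: scalar_prod_def atLeast0LessThan)
  also have "\<dots> = (\<Sum>k<n. if k = i then (B $$ (i, i))\<^sup>2 else 0)"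
  \<comment> \<open>For \<open>k \<noteq> i\<close> one of the two factors lies below the diagonal
    and vanishes.\<close>
  proof (rule sum.cong)
    fix k assume "k \<in> {..<n}"
    then show "B $$ (i, k) * B $$ (k, i) = (if k = i then (B $$ (i, i))\<^sup>2 else 0)"
      using B i by (cases k i rule: linorder_cases)
        (auto simp: power2_eq_square upper_triangularD)
  qed simp
  also have "\<dots> = (B $$ (i, i))\<^sup>2"
    using i by simp
  finally show ?thesis .
qed

lemma unitary_triangularisation:
  fixes A :: "complex mat"
  assumes A: "A \<in> carrier_mat n n"
  obtains B U where "similar_mat_wit A B U (mat_adjoint U)" "upper_triangular B"
    "matrix_energy A = (\<Sum>i<n. cmod (B $$ (i, i)))"
proof -
  obtain es where es: "char_poly A = (\<Prod>e\<leftarrow>es. [:- e, 1:])"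
    using char_poly_factorized[OF A] by blast
  obtain B U where BU: "similar_mat_wit A B U (mat_adjoint U)" "upper_triangular B"
    "diag_mat B = es"
    using unitary_schur_decomposition[OF A es] .
  have "matrix_energy A = (\<Sum>e\<leftarrow>diag_mat B. cmod e)"
    using matrix_energy_eq_sum_list[OF A es] BU(3) by simp
  also have "\<dots> = (\<Sum>i<n. cmod (B $$ (i, i)))"
    using similar_mat_witD2(5)[OF A BU(1)]
    by (simp add: diag_mat_def o_def sum_list_distinct_conv_sum_set atLeast0LessThan)
  finally show ?thesis
    using BU that by blast
qed

section \<open>Upper and lower bounds for the energy of a complex matrix\<close>

lemma matrix_energy_le_sum_norm:
  fixes A :: "complex mat"
  assumes A: "A \<in> carrier_mat n n"
  shows "matrix_energy A \<le> (\<Sum>j<n. \<Sum>k<n. cmod (A $$ (j, k)))"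
proof -
  obtain B U where sim: "similar_mat_wit A B U (mat_adjoint U)"
    and E: "matrix_energy A = (\<Sum>i<n. cmod (B $$ (i, i)))"
    using unitary_triangularisation[OF A] .
  note D = similar_mat_witD2[OF A sim]
  have rows: "(\<Sum>i<n. (cmod (U $$ (j, i)))\<^sup>2) = 1" if j: "j < n" for j
  proof -
    have "1 = (U * mat_adjoint U) $$ (j, j)"
      using D(1) j by simp
    also have "\<dots> = (\<Sum>i<n. U $$ (j, i) * cnj (U $$ (j, i)))"
      using D(6,7) j by (auto simp: scalar_prod_def index_mat_adjoint atLeast0LessThan)
    also have "\<dots> = of_real (\<Sum>i<n. (cmod (U $$ (j, i)))\<^sup>2)"
      by (simp add: complex_norm_square del: of_real_power)
    finally show ?thesis
      by (metis of_real_eq_1_iff)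
  qed
  have "similar_mat_wit B A (mat_adjoint U) U"
    using sim by (rule similar_mat_wit_sym)
  then have B: "B = mat_adjoint U * A * U"
    using similar_mat_witD2(3)[OF D(5)] by blast
  have "cmod (B $$ (i, i))
      \<le> (\<Sum>j<n. \<Sum>k<n. cmod (A $$ (j, k)) * (((cmod (U $$ (j, i)))\<^sup>2 + (cmod (U $$ (k, i)))\<^sup>2) / 2))"
    if i: "i < n" for i
  proof -
    have "B $$ (i, i) = (mat_adjoint U * (A * U)) $$ (i, i)"
      by (simp only: B assoc_mult_mat[OF D(7) A D(6)])
    also have "\<dots> = (\<Sum>j<n. cnj (U $$ (j, i)) * (\<Sum>k<n. A $$ (j, k) * U $$ (k, i)))"
      using A D(6,7) i by (auto simp: scalar_prod_def index_mat_adjoint atLeast0LessThan)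
    also have "\<dots> = (\<Sum>j<n. \<Sum>k<n. A $$ (j, k) * (cnj (U $$ (j, i)) * U $$ (k, i)))"
      by (simp add: sum_distrib_left mult_ac)
    also have "cmod \<dots> \<le> (\<Sum>j<n. \<Sum>k<n. cmod (A $$ (j, k) * (cnj (U $$ (j, i)) * U $$ (k, i))))"
      by (intro order.trans[OF norm_sum] sum_mono norm_sum)
    \<comment> \<open>AM-GM separates the two entries of \<open>U\<close>, so that each can later be
      summed over \<open>i\<close> by the unit length of a row.\<close>
    also have "\<dots> \<le> (\<Sum>j<n. \<Sum>k<n. cmod (A $$ (j, k)) *
        (((cmod (U $$ (j, i)))\<^sup>2 + (cmod (U $$ (k, i)))\<^sup>2) / 2))"
    proof (intro sum_mono)
      fix j k
      have "cmod (U $$ (j, i)) * cmod (U $$ (k, i))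
          \<le> ((cmod (U $$ (j, i)))\<^sup>2 + (cmod (U $$ (k, i)))\<^sup>2) / 2"
        using sum_squares_bound[of "cmod (U $$ (j, i))" "cmod (U $$ (k, i))"] by simp
      then show "cmod (A $$ (j, k) * (cnj (U $$ (j, i)) * U $$ (k, i)))
          \<le> cmod (A $$ (j, k)) * (((cmod (U $$ (j, i)))\<^sup>2 + (cmod (U $$ (k, i)))\<^sup>2) / 2)"
        by (simp add: norm_mult mult_left_mono del: times_divide_eq_right)
    qed
    finally show ?thesis .
  qed
  then have "matrix_energy A
      \<le> (\<Sum>i<n. \<Sum>j<n. \<Sum>k<n. cmod (A $$ (j, k)) *
          (((cmod (U $$ (j, i)))\<^sup>2 + (cmod (U $$ (k, i)))\<^sup>2) / 2))"
    unfolding E by (intro sum_mono) auto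
  \<comment> \<open>With the sum over \<open>i\<close> innermost, the weight of each entry of
    \<open>A\<close> is the mean of the squared norms of rows \<open>j\<close> and \<open>k\<close>
    of \<open>U\<close>, that is, 1.\<close>
  also have "\<dots> = (\<Sum>j<n. \<Sum>k<n. \<Sum>i<n. cmod (A $$ (j, k)) *
          (((cmod (U $$ (j, i)))\<^sup>2 + (cmod (U $$ (k, i)))\<^sup>2) / 2))"
    by (subst sum.swap, rule sum.cong, simp, rule sum.swap)
  also have "\<dots> = (\<Sum>j<n. \<Sum>k<n. cmod (A $$ (j, k)))"
    by (intro sum.cong)
      (simp_all add: rows sum.distrib
        flip: sum_distrib_left sum_divide_distrib del: times_divide_eq_right)
  finally show ?thesis .
qed

text \<open>A term of a zero sum is minus the sum of the others, so twice its modulus is at most the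
  total \<open>S\<close>. Replacing \<open>2 * cmod (x i)\<close> by \<open>S\<close> in the doubled
  sum of squares produces \<open>S\<close> squared.\<close>

lemma two_sum_squares_le_square_sum_norm:
  fixes x :: "'b \<Rightarrow> complex"
  assumes I: "finite I" and zero: "(\<Sum>i\<in>I. x i) = 0"
  shows "2 * cmod (\<Sum>i\<in>I. (x i)\<^sup>2) \<le> (\<Sum>i\<in>I. cmod (x i))\<^sup>2"
proof -
  define S where "S = (\<Sum>i\<in>I. cmod (x i))"
  have half: "2 * cmod (x i) \<le> S" if i: "i \<in> I" for i
  proof -
    have "x i = - (\<Sum>j\<in>I - {i}. x j)"
      using zero sum.remove[OF I i, of x] by (simp add: eq_neg_iff_add_eq_0)
    then have "cmod (x i) \<le> (\<Sum>j\<in>I - {i}. cmod (x j))"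
      by (simp add: norm_sum)
    then show ?thesis
      using sum.remove[OF I i, of "\<lambda>i. cmod (x i)"] by (simp add: S_def)
  qed
  have "2 * cmod (\<Sum>i\<in>I. (x i)\<^sup>2) \<le> 2 * (\<Sum>i\<in>I. (cmod (x i))\<^sup>2)"
    using norm_sum[of "\<lambda>i. (x i)\<^sup>2" I] by (simp add: norm_power)
  also have "\<dots> = (\<Sum>i\<in>I. 2 * cmod (x i) * cmod (x i))"
    by (simp add: sum_distrib_left power2_eq_square mult.assoc)
  also have "\<dots> \<le> (\<Sum>i\<in>I. S * cmod (x i))"
    by (intro sum_mono mult_right_mono half) auto
  also have "\<dots> = S\<^sup>2"
    by (simp add: S_def sum_distrib_left[symmetric] power2_eq_square)
  finally show ?thesis by (simp add: S_def)
qed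

text \<open>The double sum is the trace of \<open>A * A\<close>, which the triangular form turns
  into the sum of the squared eigenvalues. The modulus appears because this trace may be any complex
  number.\<close>

lemma matrix_energy_ge_sqrt:
  fixes A :: "complex mat"
  assumes A: "A \<in> carrier_mat n n" and tr: "(\<Sum>i<n. A $$ (i, i)) = 0"
  shows "sqrt (2 * cmod (\<Sum>i<n. \<Sum>j<n. A $$ (i, j) * A $$ (j, i))) \<le> matrix_energy A"
proof -
  obtain B U where sim: "similar_mat_wit A B U (mat_adjoint U)" and ut: "upper_triangular B"
    and E: "matrix_energy A = (\<Sum>i<n. cmod (B $$ (i, i)))"
    using unitary_triangularisation[OF A] .
  have B: "B \<in> carrier_mat n n"
    using similar_mat_witD2[OF A sim] by blast
  have tr_B: "(\<Sum>i<n. B $$ (i, i)) = 0"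
    using sum_diag_similar[OF A sim] tr by simp
  have sim2: "similar_mat_wit (A * A) (B * B) U (mat_adjoint U)"
    using similar_mat_wit_pow[OF sim, of 2] A B by (simp add: numeral_2_eq_2)
  have "(\<Sum>i<n. \<Sum>j<n. A $$ (i, j) * A $$ (j, i)) = (\<Sum>i<n. (A * A) $$ (i, i))"
    using A by (intro sum.cong) (auto simp: scalar_prod_def atLeast0LessThan)
  also have "\<dots> = (\<Sum>i<n. (B * B) $$ (i, i))"
    using A by (intro sum_diag_similar[OF _ sim2]) auto
  also have "\<dots> = (\<Sum>i<n. (B $$ (i, i))\<^sup>2)"
    by (intro sum.cong diag_square_upper_triangular[OF B ut]) auto
  finally have "2 * cmod (\<Sum>i<n. \<Sum>j<n. A $$ (i, j) * A $$ (j, i)) \<le> (matrix_energy A)\<^sup>2"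
    using two_sum_squares_le_square_sum_norm[OF _ tr_B] by (simp add: E)
  moreover have "matrix_energy A \<ge> 0"
    by (simp add: E sum_nonneg)
  ultimately show ?thesis
    by (simp add: real_le_lsqrt)
qed

section \<open>Line multigraphs of power hypergraphs\<close>

lemma finite_hedges:
  assumes "hypergraph H"
  shows "finite (hedges H)"
proof -
  have "hedges H \<subseteq> Pow (hverts H)" "finite (hverts H)"
    using assms by (auto simp: hypergraph_def)
  then show ?thesis
    by (meson finite_Pow_iff finite_subset)
qed

text \<open>Both sides count triples of a vertex and two edges through it, equal edges included: a
  vertex of degree d lies in d squared ordered pairs.\<close>

lemma sum_card_Int_eq_zagreb:
  assumes H: "hypergraph H"
  shows "(\<Sum>e\<in>hedges H. \<Sum>f\<in>hedges H. card (e \<inter> f)) = zagreb H"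
proof -
  let ?V = "hverts H" and ?E = "hedges H"
  have V: "finite ?V" and sub: "\<And>e. e \<in> ?E \<Longrightarrow> e \<subseteq> ?V"
    using H by (auto simp: hypergraph_def)
  have "card (e \<inter> f) = (\<Sum>v\<in>?V. of_bool (v \<in> e) * of_bool (v \<in> f))" if "e \<in> ?E" for e f
  proof -
    have "(\<Sum>v\<in>?V. of_bool (v \<in> e) * of_bool (v \<in> f)) = (\<Sum>v\<in>?V. of_bool (v \<in> e \<inter> f) :: nat)"
      by (rule sum.cong) auto
    also have "\<dots> = card (?V \<inter> (e \<inter> f))"
      using V by (simp add: sum_of_bool_eq Int_def)
    also have "?V \<inter> (e \<inter> f) = e \<inter> f"
      using sub[OF that] by auto
    finally show ?thesis by simp
  qed
  then have "(\<Sum>e\<in>?E. \<Sum>f\<in>?E. card (e \<inter> f))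
      = (\<Sum>e\<in>?E. \<Sum>f\<in>?E. \<Sum>v\<in>?V. of_bool (v \<in> e) * of_bool (v \<in> f))"
    by simp
  also have "\<dots> = (\<Sum>e\<in>?E. \<Sum>v\<in>?V. \<Sum>f\<in>?E. of_bool (v \<in> e) * of_bool (v \<in> f))"
    by (intro sum.cong refl sum.swap)
  also have "\<dots> = (\<Sum>v\<in>?V. \<Sum>e\<in>?E. \<Sum>f\<in>?E. of_bool (v \<in> e) * of_bool (v \<in> f))"
    by (rule sum.swap)
  also have "\<dots> = (\<Sum>v\<in>?V. (\<Sum>e\<in>?E. of_bool (v \<in> e))\<^sup>2)"
    by (simp only: power2_eq_square sum_product)
  also have "\<dots> = zagreb H"
    using finite_hedges[OF H] by (simp add: zagreb_def hdegree_def sum_of_bool_eq Int_def)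
  finally show ?thesis .
qed

lemma sum_line_multigraph_eq:
  assumes H: "hypergraph H" and k: "uniform_hypergraph k H"
  shows "(\<Sum>e\<in>hedges H. \<Sum>f\<in>hedges H. real (snd (line_multigraph H) e f))
    = real (zagreb H) - real k * real (card (hedges H))"
proof -
  let ?E = "hedges H"
  note fin = finite_hedges[OF H]
  \<comment> \<open>The line multigraph drops the pair of \<open>e\<close> with itself, which
    contributes \<open>card e = k\<close>. It is added on the left to avoid truncated
    subtraction.\<close>
  have "(\<Sum>f\<in>?E. snd (line_multigraph H) e f) + k = (\<Sum>f\<in>?E. card (e \<inter> f))" if e: "e \<in> ?E" for e
  proof -
    have "card e = k"
      using k e by (auto simp: uniform_hypergraph_def)
    moreover have "(\<Sum>f\<in>?E - {e}. snd (line_multigraph H) e f) = (\<Sum>f\<in>?E - {e}. card (e \<inter> f))"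
      by (rule sum.cong) (auto simp: line_multigraph_def)
    ultimately show ?thesis
      using sum.remove[OF fin e, of "snd (line_multigraph H) e"]
        sum.remove[OF fin e, of "\<lambda>f. card (e \<inter> f)"]
      by (simp add: line_multigraph_def)
  qed
  then have "(\<Sum>e\<in>?E. (\<Sum>f\<in>?E. snd (line_multigraph H) e f) + k) = zagreb H"
    by (simp add: sum_card_Int_eq_zagreb[OF H])
  then have "(\<Sum>e\<in>?E. \<Sum>f\<in>?E. snd (line_multigraph H) e f) + k * card ?E = zagreb H"
    by (simp add: sum.distrib mult.commute)
  then have "real (\<Sum>e\<in>?E. \<Sum>f\<in>?E. snd (line_multigraph H) e f) + real k * real (card ?E)
      = real (zagreb H)"
    by (metis of_nat_add of_nat_mult)
  then show ?thesis by simp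
qed

section \<open>Edges of the power hypergraph and their intersections, with \<open>t\<close> standing
  for \<open>r - k * s\<close>\<close>

definition power_edge :: "nat \<Rightarrow> nat \<Rightarrow> 'a set \<Rightarrow> 'a pvertex set" where
  "power_edge t s e = edge_extras t e \<union> (\<Union>v\<in>e. vertex_copies s v)"

text \<open>The original edge consists of the vertices whose copy number 0 is present; this copy
  exists because \<open>s \<ge> 1\<close>.\<close>

lemma inj_power_edge:
  assumes "s \<ge> 1"
  shows "inj (power_edge t s)"
proof (rule inj_on_inverseI[where g = "\<lambda>x. {v. Vertex_Copy v 0 \<in> x}"])
  show "{v. Vertex_Copy v 0 \<in> power_edge t s e} = e" for e :: "'a set"
    using assms by (auto simp: power_edge_def edge_extras_def vertex_copies_def image_iff)
qed

text \<open>The extra vertices of distinct edges are disjoint, so only the \<open>s\<close> copies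
  of each common vertex remain.\<close>

lemma card_power_edge_Int:
  assumes "e \<noteq> f" "finite e"
  shows "card (power_edge t s e \<inter> power_edge t s f) = s * card (e \<inter> f)"
proof -
  have "power_edge t s e \<inter> power_edge t s f = (\<Union>v\<in>e \<inter> f. vertex_copies s v)"
    using assms(1) by (auto simp: power_edge_def edge_extras_def vertex_copies_def)
  also have "card \<dots> = (\<Sum>v\<in>e \<inter> f. card (vertex_copies s v))"
    by (rule card_UN_disjoint) (use assms(2) in \<open>auto simp: vertex_copies_def\<close>)
  also have "\<dots> = s * card (e \<inter> f)"
    by (simp add: vertex_copies_def card_image inj_on_def)
  finally show ?thesis .
qed

text \<open>Passing to the power scales the adjacency matrix by \<open>s\<close>. Injectivity
  guarantees that off-diagonal pairs stay off the diagonal.\<close>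

lemma line_multigraph_power_edge:
  assumes "s \<ge> 1" "finite e"
  shows "snd (line_multigraph (power_hypergraph k r s H)) (power_edge t s e) (power_edge t s f)
    = s * snd (line_multigraph H) e f"
proof (cases "e = f")
  case False
  then have "power_edge t s e \<noteq> power_edge t s f"
    using injD[OF inj_power_edge[OF assms(1)]] by blast
  then show ?thesis
    using card_power_edge_Int[OF False assms(2)] False by (simp add: line_multigraph_def)
qed (simp add: line_multigraph_def)

lemma sum_nth_eq_sum_set:
  assumes "distinct xs"
  shows "(\<Sum>i<length xs. f (xs ! i)) = (\<Sum>x\<in>set xs. f x)"
  using sum.reindex_bij_betw[OF bij_betw_nth[OF assms refl refl]] .

theorem theorem35:
  fixes H :: "'a hypergraph" and k n m s r :: nat
  assumes "hypergraph H"
    and "k \<ge> 2" and "uniform_hypergraph k H"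
    and "linear_hypergraph H"
    and "card (hverts H) = n" and "card (hedges H) = m"
    and "s \<ge> 1" and "r \<ge> k * s"
  shows "sqrt (2 * (real s)\<^sup>2 * (real (zagreb H) - real k * real m))
           \<le> energy (line_multigraph (power_hypergraph k r s H))
       \<and> energy (line_multigraph (power_hypergraph k r s H))
           \<le> real s * (real (zagreb H) - real k * real m)"
proof -
  define N where "N = real (zagreb H) - real k * real m"
  define w where "w = snd (line_multigraph H)"
  define L where "L = line_multigraph (power_hypergraph k r s H)"
  define \<phi> :: "'a set \<Rightarrow> 'a pvertex set" where "\<phi> = power_edge (r - k * s) s"
  obtain es where es: "distinct es" "set es = hedges H"
    using finite_distinct_list[OF finite_hedges[OF assms(1)]] by blast
  \<comment> \<open>Enumerating the power edges through the edges of \<open>H\<close> lets every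
    entry be computed in \<open>H\<close>; \<open>energy_eq\<close> allows this choice of
    enumeration.\<close>
  define A where "A = adjacency_matrix L (map \<phi> es)"
  have "hedges (power_hypergraph k r s H) = \<phi> ` hedges H"
    by (simp add: power_hypergraph_def \<phi>_def power_edge_def)
  then have "fst L = set (map \<phi> es)"
    using es by (simp add: L_def line_multigraph_def)
  moreover have "distinct (map \<phi> es)"
    using es inj_on_subset[OF inj_power_edge[OF assms(7)] subset_UNIV]
    by (simp add: distinct_map \<phi>_def)
  ultimately have energy: "energy L = matrix_energy A"
    unfolding A_def by (intro energy_eq) auto
  have A: "A \<in> carrier_mat (length es) (length es)"
    by (simp add: A_def adjacency_matrix_def)
  have edge: "es ! i \<in> hedges H" if "i < length es" for i
    using nth_mem[OF that] es(2) by simp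
  have fin: "finite e" if "e \<in> hedges H" for e
    using assms(1) that unfolding hypergraph_def by (meson finite_subset)
  have A_nth: "A $$ (i, j) = of_nat (s * w (es ! i) (es ! j))"
    if "i < length es" "j < length es" for i j
    using that line_multigraph_power_edge[OF assms(7) fin[OF edge]]
    by (simp add: A_def adjacency_matrix_def L_def \<phi>_def w_def)
  have N: "(\<Sum>i<length es. \<Sum>j<length es. real (w (es ! i) (es ! j))) = N"
  proof -
    have "(\<Sum>j<length es. real (w e (es ! j))) = (\<Sum>f\<in>hedges H. real (w e f))" for e
      using sum_nth_eq_sum_set[OF es(1), of "\<lambda>f. real (w e f)"] es(2) by simp
    then show ?thesis
      using sum_nth_eq_sum_set[OF es(1), of "\<lambda>e. \<Sum>f\<in>hedges H. real (w e f)"] es(2)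
        sum_line_multigraph_eq[OF assms(1,3)] assms(6)
      by (simp add: N_def w_def)
  qed
  \<comment> \<open>As a sum of weights \<open>N\<close> is nonnegative, which later removes the
    modulus from the trace of \<open>A * A\<close>.\<close>
  have N_nonneg: "N \<ge> 0"
    unfolding N[symmetric] by (intro sum_nonneg) auto
  have "(\<Sum>i<length es. \<Sum>j<length es. cmod (A $$ (i, j)))
      = (\<Sum>i<length es. \<Sum>j<length es. real s * real (w (es ! i) (es ! j)))"
    by (intro sum.cong) (auto simp: A_nth norm_mult)
  also have "\<dots> = real s * N"
    by (simp add: N[symmetric] sum_distrib_left)
  finally have upper: "matrix_energy A \<le> real s * N"
    using matrix_energy_le_sum_norm[OF A] by simp
  \<comment> \<open>The line multigraph is loopless, which gives the vanishing trace required for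
    the lower bound.\<close>
  have "w (es ! i) (es ! i) = 0" for i
    by (simp add: w_def line_multigraph_def)
  then have "(\<Sum>i<length es. A $$ (i, i)) = 0"
    by (simp add: A_nth)
  note lower = matrix_energy_ge_sqrt[OF A this]
  \<comment> \<open>Linearity enters here: the weights are 0 or 1 and hence equal to their squares,
    so the trace of \<open>A * A\<close> is again a multiple of \<open>N\<close>.\<close>
  have "A $$ (i, j) * A $$ (j, i) = of_real ((real s)\<^sup>2 * real (w (es ! i) (es ! j)))"
    if ij: "i < length es" "j < length es" for i j
  proof -
    have "w (es ! i) (es ! j) \<le> 1"
      using assms(4) edge[OF ij(1)] edge[OF ij(2)]
      by (auto simp: w_def line_multigraph_def linear_hypergraph_def)
    moreover have "w (es ! j) (es ! i) = w (es ! i) (es ! j)"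
      by (simp add: w_def line_multigraph_def Int_commute)
    ultimately have "w (es ! i) (es ! j) * w (es ! j) (es ! i) = w (es ! i) (es ! j)"
      by (cases "w (es ! i) (es ! j)") auto
    then have "s * w (es ! i) (es ! j) * (s * w (es ! j) (es ! i)) = s\<^sup>2 * w (es ! i) (es ! j)"
      by (simp add: power2_eq_square mult.assoc mult.left_commute)
    then show ?thesis
      using ij by (simp only: A_nth of_nat_mult[symmetric]) simp
  qed
  then have "(\<Sum>i<length es. \<Sum>j<length es. A $$ (i, j) * A $$ (j, i))
      = of_real ((real s)\<^sup>2 * N)"
    by (simp add: N[symmetric] sum_distrib_left)
  then have "cmod (\<Sum>i<length es. \<Sum>j<length es. A $$ (i, j) * A $$ (j, i)) = (real s)\<^sup>2 * N"
    using N_nonneg by (simp only: norm_of_real) simp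
  then have "sqrt (2 * (real s)\<^sup>2 * N) \<le> matrix_energy A"
    using lower by (simp add: mult.assoc)
  with upper energy show ?thesis
    by (simp add: L_def N_def)
qed

end
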